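(* Let $G$ be a finite abelian group of order $v=p^s$ where $p$ is an odd prime, and suppose $2$ is self-conjugate modulo $\exp(G)$. Suppose $\{D_1,\dots,D_m\}$ is a nontrivial $(v,m,k,\lambda)$-SEDF in $G$ with $m>2$, having the simple character value property with respect to $(a,b)$. Then $a$ and $b$ are both odd.
   Context: Groups are finite abelian, written multiplicatively with identity $1$. For a subset $A\subseteq G$ we also write $A$ for $\sum_{a\in A}a\in\mathbb{Z}[G]$ and $A^{(-1)}=\sum_{a\in A}a^{-1}$. Given integers $m\ge 2$, $k\ge1$, $\lambda\ge 1$ and a group $G$ of order $v$, mutually disjoint $k$-subsets $D_1,\dots,D_m$ form a $(v,m,k,\lambda)$-SEDF in $G$ if $D_j\sum_{i\ne j}D_i^{(-1)}=\lambda(G-1)$ in $\mathbb{Z}[G]$ for each $j$; nontrivial means $k>1$. $\widehat{G}$ is the character group, characters extended linearly to $\mathbb{Z}[G]$. With $D=\bigcup_iD_i$, $\widehat{G}^N$ is the set of nonprincipal $\chi$ with $\chi(D)\ne0$. For a nontrivial SEDF with $m>2$ and $\chi\in\widehat{G}^N$, $\sqrt{1+4\lambda/|\chi(D)|^2}$ is rational; write it $b_\chi/a_\chi$ with integers $b_\chi>a_\chi>0$, $\gcd(a_\chi,b_\chi)=1$. The SEDF has the simple character value property with respect to $(a,b)$ if $(a_\chi,b_\chi)=(a,b)$ for all $\chi\in\widehat{G}^N$. A prime $q$ is self-conjugate modulo $n$ if there is an integer $j$ with $q^j\equiv-1\pmod{n_q}$, where $n_q$ is the largest divisor of $n$ not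 divisible by $q$. *)

theory Defs
  imports
    Complex_Main
    "HOL-Library.Indicator_Function"
    "HOL-Library.Disjoint_Sets"
    "HOL-Algebra.Coset"
    "HOL-Number_Theory.Cong"
begin

section \<open>Integral group rings\<close>

text \<open>
  An element of $\mathbb{Z}[G]$ is represented by its coefficient function
  \<^typ>\<open>'a \<Rightarrow> int\<close>, which is zero outside the carrier of the finite group $G$.
  A subset $A$ of $G$, viewed as the element $\sum_{a \in A} a$, is thus
  \<^term>\<open>indicator A :: 'a \<Rightarrow> int\<close>, and $A^{(-1)}$ is the indicator of the set
  of inverses \<^term>\<open>SET_INV G A\<close>.
\<close>

definition gr_mult :: "('a, 'c) monoid_scheme \<Rightarrow> ('a \<Rightarrow> int) \<Rightarrow> ('a \<Rightarrow> int) \<Rightarrow> 'a \<Rightarrow> int" where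
  "gr_mult G f g =
     (\<lambda>x. \<Sum>(y, z) \<in> {(y, z) \<in> carrier G \<times> carrier G. y \<otimes>\<^bsub>G\<^esub> z = x}. f y * g z)"


section \<open>Strong external difference families\<close>

text \<open>
  The last condition is the equation $D_j \sum_{i \ne j} D_i^{(-1)} = \lambda (G - 1)$
  in $\mathbb{Z}[G]$.
\<close>

definition SEDF ::
  "('a, 'c) monoid_scheme \<Rightarrow> nat \<Rightarrow> nat \<Rightarrow> nat \<Rightarrow> nat \<Rightarrow> (nat \<Rightarrow> 'a set) \<Rightarrow> bool" where
  "SEDF G v m k l D \<longleftrightarrow>
     comm_group G \<and> finite (carrier G) \<and> order G = v \<and>
     m \<ge> 2 \<and> k \<ge> 1 \<and> l \<ge> 1 \<and>
     (\<forall>i\<in>{1..m}. D i \<subseteq> carrier G \<and> card (D i) = k) \<and>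
     disjoint_family_on D {1..m} \<and>
     (\<forall>j\<in>{1..m}.
        gr_mult G (indicator (D j)) (\<lambda>x. \<Sum>i\<in>{1..m} - {j}. indicator (SET_INV G (D i)) x)
        = (\<lambda>x. int l * (indicator (carrier G) x - indicator {\<one>\<^bsub>G\<^esub>} x)))"

definition nontrivial_SEDF ::
  "('a, 'c) monoid_scheme \<Rightarrow> nat \<Rightarrow> nat \<Rightarrow> nat \<Rightarrow> nat \<Rightarrow> (nat \<Rightarrow> 'a set) \<Rightarrow> bool" where
  "nontrivial_SEDF G v m k l D \<longleftrightarrow> SEDF G v m k l D \<and> k > 1"


section \<open>Characters\<close>

definition complex_units :: "complex monoid" where
  "complex_units = \<lparr>carrier = UNIV - {0}, monoid.mult = (*), one = 1\<rparr>"

text \<open>Extensionality makes a character determined by its values on the carrier.\<close>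

definition characters :: "('a, 'c) monoid_scheme \<Rightarrow> ('a \<Rightarrow> complex) set" where
  "characters G = hom G complex_units \<inter> extensional (carrier G)"

definition principal_character :: "('a, 'c) monoid_scheme \<Rightarrow> 'a \<Rightarrow> complex" where
  "principal_character G = (\<lambda>x\<in>carrier G. 1)"

text \<open>The linear extension of a character to $\mathbb{Z}[G]$.\<close>

definition char_ext ::
  "('a, 'c) monoid_scheme \<Rightarrow> ('a \<Rightarrow> complex) \<Rightarrow> ('a \<Rightarrow> int) \<Rightarrow> complex" where
  "char_ext G \<chi> f = (\<Sum>x\<in>carrier G. of_int (f x) * \<chi> x)"

text \<open>The set $\widehat{G}^N$ attached to a subset $D$ of $G$.\<close>

definition chars_N :: "('a, 'c) monoid_scheme \<Rightarrow> 'a set \<Rightarrow> ('a \<Rightarrow> complex) set" where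
  "chars_N G D =
     {\<chi> \<in> characters G. \<chi> \<noteq> principal_character G \<and> char_ext G \<chi> (indicator D) \<noteq> 0}"


section \<open>The simple character value property\<close>

text \<open>
  The relation ``$(a,b) = (a_\chi, b_\chi)$''. The lowest-terms representation of a
  positive rational is unique, so at most one pair is related to a given \<open>\<chi>\<close>; a pair
  exists exactly if the square root is rational.
\<close>

definition char_value_pair ::
  "('a, 'c) monoid_scheme \<Rightarrow> nat \<Rightarrow> 'a set \<Rightarrow> ('a \<Rightarrow> complex) \<Rightarrow> int \<Rightarrow> int \<Rightarrow> bool" where
  "char_value_pair G l D \<chi> a b \<longleftrightarrow>
     b > a \<and> a > 0 \<and> coprime a b \<and>
     sqrt (1 + 4 * real l / (cmod (char_ext G \<chi> (indicator D)))\<^sup>2) = of_int b / of_int a"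

lemma char_value_pair_unique:
  assumes "char_value_pair G l D \<chi> a b" and "char_value_pair G l D \<chi> a' b'"
  shows "a = a' \<and> b = b'"
proof -
  from assms have pos: "a > 0" "a' > 0" "b > 0" "b' > 0"
    and cop: "coprime a b" "coprime a' b'"
    and eq: "(of_int b / of_int a :: real) = of_int b' / of_int a'"
    unfolding char_value_pair_def by auto
  from eq pos have "real_of_int (b * a') = real_of_int (b' * a)"
    by (simp add: field_simps)
  then have "b * a' = b' * a"
    by (simp only: of_int_eq_iff)
  then have "a dvd b * a'" "a' dvd b' * a"
    by (metis dvd_triv_right)+
  then have "a dvd a'" "a' dvd a"
    using cop by (simp_all add: coprime_dvd_mult_right_iff)
  then have "a = a'"
    using pos by (simp add: zdvd_antisym_nonneg)
  with \<open>b * a' = b' * a\<close> pos show ?thesis by simp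
qed

definition simple_char_value_property ::
  "('a, 'c) monoid_scheme \<Rightarrow> nat \<Rightarrow> nat \<Rightarrow> (nat \<Rightarrow> 'a set) \<Rightarrow> int \<Rightarrow> int \<Rightarrow> bool" where
  "simple_char_value_property G m l D a b \<longleftrightarrow>
     (\<forall>\<chi>\<in>chars_N G (\<Union>i\<in>{1..m}. D i). char_value_pair G l (\<Union>i\<in>{1..m}. D i) \<chi> a b)"


section \<open>Self-conjugacy\<close>

definition group_exponent :: "('a, 'c) monoid_scheme \<Rightarrow> nat" where
  "group_exponent G = (LEAST n. n > 0 \<and> (\<forall>x\<in>carrier G. x [^]\<^bsub>G\<^esub> n = \<one>\<^bsub>G\<^esub>))"

definition prime_free_part :: "nat \<Rightarrow> nat \<Rightarrow> nat" where
  "prime_free_part q n = Max {d. d dvd n \<and> \<not> q dvd d}"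

text \<open>
  Since \<open>q\<close> is a unit of finite order modulo \<open>prime_free_part q n\<close>, negative exponents
  contribute no further residues, so a natural number exponent suffices.
\<close>

definition self_conjugate :: "nat \<Rightarrow> nat \<Rightarrow> bool" where
  "self_conjugate q n \<longleftrightarrow> (\<exists>j::nat. [int q ^ j = -1] (mod int (prime_free_part q n)))"

end

theory Submission
  imports Defs "HOL-Algebra.Multiplicative_Group" "HOL-Library.Z2"
begin

text \<open>
  Put \<open>x = \<chi>(D)\<close> and \<open>y = \<chi>(D\<^sub>1)\<close> for a nonprincipal character \<open>\<chi>\<close>. The defining equation gives
  \<open>y * cnj (x - y) = - \<lambda>\<close>, and if \<open>x \<noteq> 0\<close> this amounts to \<open>(2 a y - a x)\<^sup>2 = b\<^sup>2 x\<^sup>2\<close>. After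
  multiplication by \<open>x\<^sup>2\<close> the identity holds for every nonprincipal \<open>\<chi>\<close>, so
  \<open>((2 a D\<^sub>1 - a D)\<^sup>2 - b\<^sup>2 D\<^sup>2) D\<^sup>2\<close> is a multiple of \<open>G\<close> in the integral group ring. Modulo 2 this
  element is \<open>(a\<^sup>2 - b\<^sup>2) D\<^sup>4\<close>. If \<open>a\<close> and \<open>b\<close> had opposite parity, \<open>D\<^sup>4\<close> would be constant
  modulo 2; but \<open>D\<^sup>4\<close> is there the set of fourth powers of elements of \<open>D\<close>, by the Frobenius
  identity, and \<open>|G|\<close> is odd, so \<open>D = G\<close>. Then \<open>v = m k\<close>, which contradicts
  \<open>k\<^sup>2 (m - 1) = \<lambda> (v - 1)\<close> for \<open>k > 1\<close>. If \<open>\<chi>(D) = 0\<close> for all nonprincipal \<open>\<chi>\<close>, then \<open>D\<close> itself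
  is constant and the same contradiction arises.
\<close>

section \<open>Characters of finite abelian groups\<close>

lemma hom_complex_units_iff:
  "\<phi> \<in> hom G complex_units \<longleftrightarrow>
     (\<forall>x\<in>carrier G. \<phi> x \<noteq> 0) \<and>
     (\<forall>x\<in>carrier G. \<forall>y\<in>carrier G. \<phi> (x \<otimes>\<^bsub>G\<^esub> y) = \<phi> x * \<phi> y)"
  by (auto simp: hom_def complex_units_def)

lemma exists_nth_root:
  fixes z :: complex
  assumes "n > 0" and "z \<noteq> 0"
  shows "\<exists>w. w ^ n = z"
proof -
  have "card {w. w ^ n = z} > 0"
    using card_nth_roots[OF assms(2,1)] assms(1) by simp
  then show ?thesis
    by (metis (mono_tags, lifting) Collect_empty_eq card_gt_0_iff)
qed

lemma exists_nontrivial_root_of_unity: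
  assumes "n > 1"
  shows "\<exists>w::complex. w ^ n = 1 \<and> w \<noteq> 1"
proof -
  have "card {w::complex. w ^ n = 1} = n"
    using assms by (intro card_roots_unity_eq) simp
  then have "\<not> {w::complex. w ^ n = 1} \<subseteq> {1}"
    using assms card_mono[of "{1::complex}" "{w. w ^ n = 1}"] by auto
  then show ?thesis by auto
qed

context comm_group
begin

section \<open>Extension of characters from a subgroup to the whole group\<close>

lemma hom_power_complex_units:
  assumes "subgroup H G" and "\<phi> \<in> hom (G\<lparr>carrier := H\<rparr>) complex_units" and "h \<in> H"
  shows "\<phi> (h [^] (n::nat)) = \<phi> h ^ n" and "h [^] n \<in> H"
proof -
  interpret H: subgroup H G by fact
  have one: "\<phi> \<one> = 1"
  proof -
    have nz: "\<forall>x\<in>H. \<phi> x \<noteq> 0" and mult: "\<forall>x\<in>H. \<forall>y\<in>H. \<phi> (x \<otimes> y) = \<phi> x * \<phi> y"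
      using assms(2) by (simp_all add: hom_complex_units_iff)
    have "\<phi> \<one> * \<phi> \<one> = \<phi> (\<one> \<otimes> \<one>)"
      using mult H.one_closed by metis
    then have "\<phi> \<one> * \<phi> \<one> = \<phi> \<one> * 1" by simp
    then show ?thesis using nz H.one_closed by (metis mult_left_cancel)
  qed
  have pow: "h [^] n \<in> H" for n :: nat
    using assms(3) by (induction n) auto
  then show "h [^] n \<in> H" .
  show "\<phi> (h [^] n) = \<phi> h ^ n"
    using assms(2,3) pow one by (induction n) (auto simp: hom_complex_units_iff)
qed

text \<open>In a finite group \<open>inv g\<close> is the power \<open>g [^] (order G - 1)\<close>,
  so natural exponents already give closure under inverses.\<close>

lemma subgroup_adjoin:
  assumes "finite (carrier G)" and "subgroup H G" and g: "g \<in> carrier G"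
  shows "subgroup {h \<otimes> g [^] (i::nat) |h i. h \<in> H} G"
proof -
  interpret H: subgroup H G by fact
  have "inv g = g [^] (order G - 1)"
  proof -
    have "order G = Suc (order G - 1)"
      using order_gt_0_iff_finite assms(1) by simp
    then have "g [^] (order G - 1) \<otimes> g = \<one>"
      using pow_order_eq_1[OF g] by (metis nat_pow_Suc)
    then show ?thesis
      using g by (simp add: inv_equality)
  qed
  then have inv_pow: "inv (g [^] i) = g [^] ((order G - 1) * i)" for i :: nat
    using g by (metis nat_pow_inv nat_pow_pow)
  show ?thesis
  proof (rule subgroupI)
    show "{h \<otimes> g [^] (i::nat) |h i. h \<in> H} \<subseteq> carrier G"
      using g by auto
    show "{h \<otimes> g [^] (i::nat) |h i. h \<in> H} \<noteq> {}"
      using H.one_closed by blast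
  next
    fix x assume "x \<in> {h \<otimes> g [^] (i::nat) |h i. h \<in> H}"
    then obtain h i where "h \<in> H" "x = h \<otimes> g [^] (i::nat)" by blast
    then have "inv x = inv h \<otimes> g [^] ((order G - 1) * i)" and "inv h \<in> H"
      using g by (auto simp: inv_mult inv_pow)
    then show "inv x \<in> {h \<otimes> g [^] (i::nat) |h i. h \<in> H}" by blast
  next
    fix x y
    assume "x \<in> {h \<otimes> g [^] (i::nat) |h i. h \<in> H}" "y \<in> {h \<otimes> g [^] (i::nat) |h i. h \<in> H}"
    then obtain h i h' j where *: "h \<in> H" "x = h \<otimes> g [^] (i::nat)"
      "h' \<in> H" "y = h' \<otimes> g [^] (j::nat)" by blast
    then have "x \<otimes> y = (h \<otimes> h') \<otimes> (g [^] i \<otimes> g [^] j)"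
      using g by (simp add: m_ac)
    then have "x \<otimes> y = (h \<otimes> h') \<otimes> g [^] (i + j)" and "h \<otimes> h' \<in> H"
      using g * by (auto simp: nat_pow_mult)
    then show "x \<otimes> y \<in> {h \<otimes> g [^] (i::nat) |h i. h \<in> H}" by blast
  qed
qed

text \<open>By minimality of \<open>n\<close>, two representations
  \<open>h \<otimes> g [^] i\<close> of the same element have exponents differing by a multiple of
  \<open>n\<close>, so \<open>w ^ n = \<phi> (g [^] n)\<close> is the only constraint on the value
  at \<open>g\<close>. The root \<open>w\<close> is a parameter because separation of elements
  requires a particular choice of it.\<close>

lemma extend_character_step:
  assumes fin: "finite (carrier G)" and H: "subgroup H G"
    and \<phi>: "\<phi> \<in> hom (G\<lparr>carrier := H\<rparr>) complex_units" and g: "g \<in> carrier G"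
    and n: "n > 0" "g [^] n \<in> H" "\<And>m. 0 < m \<Longrightarrow> m < n \<Longrightarrow> g [^] m \<notin> H"
    and w: "w ^ n = \<phi> (g [^] n)"
  shows "\<exists>H' \<phi>'. subgroup H' G \<and> H \<subseteq> H' \<and> g \<in> H' \<and>
           \<phi>' \<in> hom (G\<lparr>carrier := H'\<rparr>) complex_units \<and> (\<forall>h\<in>H. \<phi>' h = \<phi> h) \<and> \<phi>' g = w"
proof -
  interpret H: subgroup H G by fact
  define H' where "H' = {h \<otimes> g [^] (i::nat) |h i. h \<in> H}"
  have mult: "\<phi> (x \<otimes> y) = \<phi> x * \<phi> y" if "x \<in> H" "y \<in> H" for x y
    using \<phi> that by (auto simp: hom_complex_units_iff)
  have nz: "\<phi> x \<noteq> 0" if "x \<in> H" for x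
    using \<phi> that by (auto simp: hom_complex_units_iff)
  have "w \<noteq> 0"
    using w nz[OF n(2)] n(1) by (auto simp: power_0_left)
  have wd_le: "\<phi> h * w ^ i = \<phi> h' * w ^ j"
    if hh: "h \<in> H" "h' \<in> H" and eq: "h \<otimes> g [^] i = h' \<otimes> g [^] j" and "i \<le> j"
    for h h' and i j :: nat
  proof -
    define d where "d = j - i"
    have j: "j = d + i" using \<open>i \<le> j\<close> by (simp add: d_def)
    have "h \<otimes> g [^] i = (h' \<otimes> g [^] d) \<otimes> g [^] i"
      using eq hh g by (simp add: j m_assoc nat_pow_mult)
    then have hd: "h = h' \<otimes> g [^] d"
      using hh g by (metis H.mem_carrier m_closed nat_pow_closed right_cancel)
    then have "g [^] d = inv h' \<otimes> h"
      using hh g by (simp add: inv_solve_left)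
    then have dH: "g [^] d \<in> H" using hh by simp
    \<comment> \<open>Both \<open>g [^] d\<close> and \<open>g [^] (n * q)\<close> lie in
      \<open>H\<close>, hence so does \<open>g [^] r\<close> with \<open>r < n\<close>; minimality
      of \<open>n\<close> then leaves only \<open>r = 0\<close>.\<close>
    define q where "q = d div n"
    define r where "r = d mod n"
    have d: "d = n * q + r" by (simp add: q_def r_def)
    have nq: "g [^] (n * q) = (g [^] n) [^] q" "(g [^] n) [^] q \<in> H"
      using g hom_power_complex_units(2)[OF H \<phi> n(2)] by (simp_all add: nat_pow_pow)
    have "g [^] d = g [^] (n * q) \<otimes> g [^] r"
      using g by (simp add: d nat_pow_mult)
    then have "g [^] r = inv (g [^] (n * q)) \<otimes> g [^] d"
      using g by (simp add: inv_solve_left)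
    then have "g [^] r \<in> H" using nq dH by simp
    moreover have "r < n" using n(1) by (simp add: r_def)
    ultimately have "r = 0" using n(3) by blast
    then have "\<phi> (g [^] d) = \<phi> (g [^] n) ^ q"
      using nq hom_power_complex_units(1)[OF H \<phi> n(2)] by (simp add: d)
    also have "\<dots> = w ^ d"
      using \<open>r = 0\<close> by (simp add: d w[symmetric] power_mult)
    finally show ?thesis
      using hd mult[OF hh(2) dH] by (simp add: j power_add)
  qed
  have wd: "\<phi> h * w ^ i = \<phi> h' * w ^ j"
    if "h \<in> H" "h' \<in> H" "h \<otimes> g [^] i = h' \<otimes> g [^] j" for h h' and i j :: nat
    using wd_le[of h h' i j] wd_le[of h' h j i] that by (cases "i \<le> j") auto
  \<comment> \<open>The choice ranges over all representations of \<open>x\<close>; by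
    \<open>wd\<close> they all yield the same value. Outside \<open>H'\<close> the value is
    arbitrary.\<close>
  define \<phi>' where "\<phi>' x = (SOME z. \<exists>h i. h \<in> H \<and> x = h \<otimes> g [^] (i::nat) \<and> z = \<phi> h * w ^ i)" for x
  have val: "\<phi>' (h \<otimes> g [^] i) = \<phi> h * w ^ i" if "h \<in> H" for h and i :: nat
    unfolding \<phi>'_def
  proof (rule some_equality)
    show "\<exists>h' j. h' \<in> H \<and> h \<otimes> g [^] i = h' \<otimes> g [^] (j::nat) \<and> \<phi> h * w ^ i = \<phi> h' * w ^ j"
      using that by blast
  next
    fix z assume "\<exists>h' j. h' \<in> H \<and> h \<otimes> g [^] i = h' \<otimes> g [^] (j::nat) \<and> z = \<phi> h' * w ^ j"
    then show "z = \<phi> h * w ^ i" using wd that by metis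
  qed
  have one: "\<phi> \<one> = 1"
    using hom_power_complex_units(1)[OF H \<phi> H.one_closed, of 0] by simp
  have "subgroup H' G"
    unfolding H'_def using subgroup_adjoin fin H g .
  moreover have "h \<in> H'" "\<phi>' h = \<phi> h" if "h \<in> H" for h
  proof -
    have "h = h \<otimes> g [^] (0::nat)" using that by simp
    then show "h \<in> H'" unfolding H'_def using that by blast
    show "\<phi>' h = \<phi> h" using val[OF that, of 0] that by simp
  qed
  moreover have "g \<in> H'" "\<phi>' g = w"
  proof -
    have "g = \<one> \<otimes> g [^] (1::nat)" using g by simp
    then show "g \<in> H'" unfolding H'_def using H.one_closed by blast
    show "\<phi>' g = w" using val[OF H.one_closed, of 1] g by (simp add: one)
  qed
  moreover have "\<phi>' \<in> hom (G\<lparr>carrier := H'\<rparr>) complex_units"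
    unfolding hom_complex_units_iff
  proof (intro conjI ballI; simp)
    fix x assume "x \<in> H'"
    then show "\<phi>' x \<noteq> 0"
      unfolding H'_def using val nz \<open>w \<noteq> 0\<close> by auto
  next
    fix x y assume "x \<in> H'" "y \<in> H'"
    then obtain h i h' j where *: "h \<in> H" "x = h \<otimes> g [^] (i::nat)"
      "h' \<in> H" "y = h' \<otimes> g [^] (j::nat)" unfolding H'_def by blast
    then have "x \<otimes> y = (h \<otimes> h') \<otimes> (g [^] i \<otimes> g [^] j)"
      using g by (simp add: m_ac)
    then have "x \<otimes> y = (h \<otimes> h') \<otimes> g [^] (i + j)"
      using g * by (auto simp: nat_pow_mult)
    then show "\<phi>' (x \<otimes> y) = \<phi>' x * \<phi>' y"
      using * by (simp add: val mult power_add)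
  qed
  ultimately show ?thesis by blast
qed

lemma least_power_in_subgroup:
  assumes "finite (carrier G)" and "subgroup H G" and "g \<in> carrier G"
  obtains n :: nat where "n > 0" "g [^] n \<in> H" "\<And>m. 0 < m \<Longrightarrow> m < n \<Longrightarrow> g [^] m \<notin> H"
proof -
  let ?P = "\<lambda>n::nat. n > 0 \<and> g [^] n \<in> H"
  have "?P (order G)"
    using assms order_gt_0_iff_finite pow_order_eq_1 subgroup.one_closed by metis
  then have "?P (LEAST n. ?P n)" by (rule LeastI)
  moreover have "\<not> ?P m" if "m < (LEAST n. ?P n)" for m
    using that by (rule not_less_Least)
  ultimately show ?thesis using that by blast
qed

text \<open>Elements are adjoined one at a time, by induction on the number of elements outside
  \<open>H\<close>. Each step succeeds because every nonzero complex number has an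
  \<open>n\<close>-th root.\<close>

lemma extend_character:
  assumes fin: "finite (carrier G)" and "subgroup H G"
    and "\<phi> \<in> hom (G\<lparr>carrier := H\<rparr>) complex_units"
  shows "\<exists>\<chi>\<in>hom G complex_units. \<forall>h\<in>H. \<chi> h = \<phi> h"
  using assms(2,3)
proof (induction "card (carrier G - H)" arbitrary: H \<phi> rule: less_induct)
  case less
  show ?case
  proof (cases "H = carrier G")
    case True
    then show ?thesis using less.prems by auto
  next
    case False
    then obtain g where g: "g \<in> carrier G" "g \<notin> H"
      using subgroup.subset[OF less.prems(1)] by blast
    obtain n :: nat where n: "n > 0" "g [^] n \<in> H" "\<And>m. 0 < m \<Longrightarrow> m < n \<Longrightarrow> g [^] m \<notin> H"
      using least_power_in_subgroup[OF fin less.prems(1) g(1)] by blast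
    have "\<phi> (g [^] n) \<noteq> 0"
      using less.prems(2) n(2) by (simp add: hom_complex_units_iff)
    then obtain w where w: "w ^ n = \<phi> (g [^] n)"
      using exists_nth_root n(1) by blast
    obtain H' \<phi>' where H': "subgroup H' G" "H \<subseteq> H'" "g \<in> H'"
      "\<phi>' \<in> hom (G\<lparr>carrier := H'\<rparr>) complex_units" "\<forall>h\<in>H. \<phi>' h = \<phi> h"
      using extend_character_step[OF fin less.prems g(1) n w] by blast
    have "card (carrier G - H') < card (carrier G - H)"
      using H' g fin by (intro psubset_card_mono) auto
    from less.hyps[OF this H'(1,4)] show ?thesis using H' by (metis subsetD)
  qed
qed

text \<open>The trivial character of \<open>{\<one>}\<close> is extended to the subgroup generated
  by \<open>x\<close>. There \<open>n\<close> is the order of \<open>x\<close>, and an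
  \<open>n\<close>-th root of unity other than 1 may be prescribed at \<open>x\<close>.\<close>

lemma character_separates:
  assumes fin: "finite (carrier G)" and x: "x \<in> carrier G" "x \<noteq> \<one>"
  shows "\<exists>\<chi>\<in>characters G. \<chi> x \<noteq> 1"
proof -
  have H: "subgroup {\<one>} G" by (rule triv_subgroup)
  have \<phi>: "(\<lambda>_. 1) \<in> hom (G\<lparr>carrier := {\<one>}\<rparr>) complex_units"
    by (simp add: hom_complex_units_iff)
  obtain n :: nat where n: "n > 0" "x [^] n \<in> {\<one>}" "\<And>m. 0 < m \<Longrightarrow> m < n \<Longrightarrow> x [^] m \<notin> {\<one>}"
    using least_power_in_subgroup[OF fin H x(1)] by blast
  have "n \<noteq> 1" using n(2) x by auto
  then obtain w :: complex where w: "w ^ n = 1" "w \<noteq> 1"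
    using exists_nontrivial_root_of_unity[of n] n(1) by auto
  obtain H' \<phi>' where H': "subgroup H' G" "x \<in> H'"
      "\<phi>' \<in> hom (G\<lparr>carrier := H'\<rparr>) complex_units" "\<phi>' x = w"
    using extend_character_step[OF fin H \<phi> x(1) n w(1)] by blast
  from extend_character[OF fin H'(1,3)] obtain \<chi>
    where \<chi>: "\<chi> \<in> hom G complex_units" "\<chi> x = w"
    using H'(2,4) by metis
  \<comment> \<open>Restriction supplies the extensionality that \<open>characters\<close>
    demands.\<close>
  have "restrict \<chi> (carrier G) \<in> characters G"
    using \<chi>(1) by (auto simp: characters_def hom_complex_units_iff)
  then show ?thesis using \<chi>(2) w(2) x(1) by (intro bexI[of _ "restrict \<chi> (carrier G)"]) auto
qed

section \<open>Character values and orthogonality relations\<close>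

lemma character_mult:
  "\<chi> \<in> characters G \<Longrightarrow> x \<in> carrier G \<Longrightarrow> y \<in> carrier G \<Longrightarrow> \<chi> (x \<otimes> y) = \<chi> x * \<chi> y"
  by (simp add: characters_def hom_complex_units_iff)

lemma character_nonzero: "\<chi> \<in> characters G \<Longrightarrow> x \<in> carrier G \<Longrightarrow> \<chi> x \<noteq> 0"
  by (simp add: characters_def hom_complex_units_iff)

lemma character_one:
  assumes "\<chi> \<in> characters G"
  shows "\<chi> \<one> = 1"
  using character_mult[OF assms one_closed one_closed] character_nonzero[OF assms one_closed]
  by simp

lemma character_power_order:
  assumes "\<chi> \<in> characters G" and "x \<in> carrier G"
  shows "\<chi> x ^ order G = 1"
proof -
  have "\<chi> (x [^] order G) = \<chi> x ^ order G"
    using assms by (intro hom_power_complex_units(1)[OF subgroup_self]) (auto simp: characters_def)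
  then show ?thesis
    using pow_order_eq_1[OF assms(2)] character_one[OF assms(1)] by simp
qed

text \<open>Character values are roots of unity, hence of modulus 1, so inversion agrees with
  conjugation.\<close>

lemma character_inv:
  assumes "finite (carrier G)" and \<chi>: "\<chi> \<in> characters G" and x: "x \<in> carrier G"
  shows "\<chi> (inv x) = cnj (\<chi> x)"
proof -
  have "cmod (\<chi> x) ^ order G = 1"
    using character_power_order[OF \<chi> x] by (metis norm_one norm_power)
  moreover have "order G > 0"
    using assms(1) order_gt_0_iff_finite by simp
  ultimately have "cmod (\<chi> x) = 1"
    using power_eq_imp_eq_base[of "cmod (\<chi> x)" "order G" 1] by simp
  then have "\<chi> x * cnj (\<chi> x) = 1"
    by (simp add: complex_norm_square[symmetric])
  moreover have "\<chi> x * \<chi> (inv x) = 1"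
    using character_mult[OF \<chi> x inv_closed[OF x]] character_one[OF \<chi>] x by simp
  ultimately show ?thesis
    using character_nonzero[OF \<chi> x] by (metis mult_left_cancel)
qed

lemma principal_character_mem: "principal_character G \<in> characters G"
  by (auto simp: principal_character_def characters_def hom_complex_units_iff)

lemma finite_characters:
  assumes "finite (carrier G)"
  shows "finite (characters G)"
proof (rule finite_subset)
  show "characters G \<subseteq> carrier G \<rightarrow>\<^sub>E {z. z ^ order G = 1}"
  proof (intro subsetI PiE_I)
    fix \<chi> x assume "\<chi> \<in> characters G" "x \<notin> carrier G"
    then show "\<chi> x = undefined" by (auto simp: characters_def extensional_def)
  qed (simp add: character_power_order)
  have "order G > 0" using assms order_gt_0_iff_finite by simp
  then show "finite (carrier G \<rightarrow>\<^sub>E {z::complex. z ^ order G = 1})"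
    using assms by (intro finite_PiE) auto
qed

text \<open>Multiplication by a character \<open>\<psi>\<close> with
  \<open>\<psi> x \<noteq> 1\<close> permutes the characters, so the sum equals
  \<open>\<psi> x\<close> times itself.\<close>

lemma sum_characters_eq_0:
  assumes "finite (carrier G)" and x: "x \<in> carrier G" "x \<noteq> \<one>"
  shows "(\<Sum>\<chi>\<in>characters G. \<chi> x) = 0"
proof -
  obtain \<psi> where \<psi>: "\<psi> \<in> characters G" "\<psi> x \<noteq> 1"
    using character_separates assms by blast
  let ?f = "\<lambda>\<chi>. \<lambda>y\<in>carrier G. \<psi> y * \<chi> y" and ?g = "\<lambda>\<chi>. \<lambda>y\<in>carrier G. \<chi> y / \<psi> y"
  have ext: "\<chi> \<in> extensional (carrier G)" if "\<chi> \<in> characters G" for \<chi>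
    using that by (simp add: characters_def)
  have "(\<Sum>\<chi>\<in>characters G. \<psi> x * \<chi> x) = (\<Sum>\<chi>\<in>characters G. \<chi> x)"
  proof (rule sum.reindex_bij_witness[where i = ?g and j = ?f])
    fix \<chi> assume \<chi>: "\<chi> \<in> characters G"
    show "?g (?f \<chi>) = \<chi>" "?f (?g \<chi>) = \<chi>"
      using ext[OF \<chi>] character_nonzero[OF \<psi>(1)] by (auto simp: fun_eq_iff extensional_def)
    show "?f \<chi> \<in> characters G" "?g \<chi> \<in> characters G"
      using \<chi> \<psi>(1) by (auto simp: characters_def hom_complex_units_iff)
    show "?f \<chi> x = \<psi> x * \<chi> x" using x by simp
  qed
  then have "\<psi> x * (\<Sum>\<chi>\<in>characters G. \<chi> x) = 1 * (\<Sum>\<chi>\<in>characters G. \<chi> x)"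
    by (simp add: sum_distrib_left)
  then show ?thesis using \<psi>(2) by (metis mult_right_cancel)
qed

text \<open>This is Fourier inversion: up to the factor \<open>?N\<close>, the coefficient
  \<open>F g\<close> is the sum of \<open>char_ext G \<chi> F * \<chi> (inv g)\<close> over all
  characters. Only the principal term survives, and it does not depend on \<open>g\<close>.\<close>

lemma constant_if_nonprincipal_eq_0:
  assumes fin: "finite (carrier G)"
    and zero: "\<And>\<chi>. \<chi> \<in> characters G \<Longrightarrow> \<chi> \<noteq> principal_character G \<Longrightarrow> char_ext G \<chi> F = 0"
    and "g \<in> carrier G" "h \<in> carrier G"
  shows "F g = F h"
proof -
  let ?N = "of_nat (card (characters G)) :: complex"
  have *: "?N * of_int (F g) = char_ext G (principal_character G) F" if g: "g \<in> carrier G" for g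
  proof -
    have inner: "(\<Sum>\<chi>\<in>characters G. \<chi> (x \<otimes> inv g)) = (if x = g then ?N else 0)"
      if x: "x \<in> carrier G" for x
    proof (cases "x = g")
      case True
      then show ?thesis using g by (simp add: character_one)
    next
      case False
      then have "x \<otimes> inv g \<noteq> \<one>"
        using x g by (metis inv_closed inv_equality inv_inv)
      then show ?thesis using False x g sum_characters_eq_0[OF fin] by simp
    qed
    have "?N * of_int (F g) = (\<Sum>x\<in>carrier G. of_int (F x) * (if x = g then ?N else 0))"
      using g fin by (simp add: if_distrib cong: if_cong)
    also have "\<dots> = (\<Sum>x\<in>carrier G. of_int (F x) * (\<Sum>\<chi>\<in>characters G. \<chi> (x \<otimes> inv g)))"
      using inner by (intro sum.cong) auto
    also have "\<dots> = (\<Sum>\<chi>\<in>characters G. \<Sum>x\<in>carrier G. of_int (F x) * \<chi> (x \<otimes> inv g))"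
      by (subst sum.swap) (simp add: sum_distrib_left)
    also have "\<dots> = (\<Sum>\<chi>\<in>characters G. char_ext G \<chi> F * \<chi> (inv g))"
      unfolding char_ext_def sum_distrib_right
      using g by (intro sum.cong) (auto simp: character_mult)
    also have "\<dots> = (\<Sum>\<chi>\<in>{principal_character G}. char_ext G \<chi> F * \<chi> (inv g))"
      using finite_characters[OF fin] principal_character_mem zero
      by (intro sum.mono_neutral_right) auto
    also have "\<dots> = char_ext G (principal_character G) F"
      using g by (simp add: principal_character_def)
    finally show ?thesis .
  qed
  have "card (characters G) > 0"
    using finite_characters[OF fin] principal_character_mem card_gt_0_iff by blast
  then have "?N \<noteq> 0" by simp
  moreover have "?N * of_int (F g) = ?N * of_int (F h)"
    using *[OF assms(3)] *[OF assms(4)] by simp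
  ultimately have "(of_int (F g) :: complex) = of_int (F h)"
    by (metis mult_left_cancel)
  then show ?thesis by (simp only: of_int_eq_iff)
qed

text \<open>Dually, translation by some \<open>y\<close> with \<open>\<chi> y \<noteq> 1\<close>
  permutes the group and multiplies the sum by \<open>\<chi> y\<close>.\<close>

lemma sum_character_eq_0:
  assumes fin: "finite (carrier G)" and \<chi>: "\<chi> \<in> characters G" "\<chi> \<noteq> principal_character G"
  shows "(\<Sum>x\<in>carrier G. \<chi> x) = 0"
proof -
  obtain y where y: "y \<in> carrier G" "\<chi> y \<noteq> 1"
  proof (rule ccontr)
    assume "\<not> thesis"
    then have "\<forall>y\<in>carrier G. \<chi> y = 1" using that by blast
    then have "\<chi> = principal_character G"
      using \<chi>(1) by (auto simp: principal_character_def characters_def extensional_def fun_eq_iff)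
    with \<chi>(2) show False by simp
  qed
  have "(\<Sum>x\<in>carrier G. \<chi> y * \<chi> x) = (\<Sum>x\<in>carrier G. \<chi> x)"
  proof (rule sum.reindex_bij_witness[where i = "\<lambda>x. inv y \<otimes> x" and j = "\<lambda>x. y \<otimes> x"])
    fix x assume x: "x \<in> carrier G"
    show "inv y \<otimes> (y \<otimes> x) = x" "y \<otimes> (inv y \<otimes> x) = x"
      using x y(1) by (simp_all add: m_assoc[symmetric])
    show "\<chi> (y \<otimes> x) = \<chi> y * \<chi> x" using x y(1) character_mult[OF \<chi>(1)] by simp
  qed (use y in auto)
  then have "\<chi> y * (\<Sum>x\<in>carrier G. \<chi> x) = 1 * (\<Sum>x\<in>carrier G. \<chi> x)"
    by (simp add: sum_distrib_left)
  then show ?thesis using y(2) by (metis mult_right_cancel)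
qed

end


section \<open>The integral group ring\<close>

context comm_group
begin

lemma char_ext_gr_mult:
  assumes fin: "finite (carrier G)" and \<chi>: "\<chi> \<in> characters G"
  shows "char_ext G \<chi> (gr_mult G f g) = char_ext G \<chi> f * char_ext G \<chi> g"
proof -
  let ?C = "carrier G"
  let ?t = "\<lambda>(y, z). of_int (f y) * of_int (g z) * \<chi> (y \<otimes> z)"
  have "char_ext G \<chi> (gr_mult G f g) =
      (\<Sum>x\<in>?C. \<Sum>p\<in>{p \<in> ?C \<times> ?C. (case p of (y, z) \<Rightarrow> y \<otimes> z) = x}. ?t p)"
    unfolding char_ext_def gr_mult_def
    by (rule sum.cong) (auto simp: sum_distrib_right intro!: sum.cong)
  also have "\<dots> = (\<Sum>p\<in>?C \<times> ?C. ?t p)"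
    using fin by (intro sum.group) auto
  also have "\<dots> = (\<Sum>(y, z)\<in>?C \<times> ?C. (of_int (f y) * \<chi> y) * (of_int (g z) * \<chi> z))"
    by (rule sum.cong) (auto simp: character_mult[OF \<chi>])
  finally show ?thesis
    by (simp add: char_ext_def sum_product sum.cartesian_product)
qed

lemma char_ext_indicator:
  assumes "finite (carrier G)" and "A \<subseteq> carrier G"
  shows "char_ext G \<chi> (indicator A) = (\<Sum>x\<in>A. \<chi> x)"
proof -
  have "char_ext G \<chi> (indicator A) = (\<Sum>x\<in>carrier G. if x \<in> A then \<chi> x else 0)"
    unfolding char_ext_def by (rule sum.cong) (auto simp: indicator_def)
  then show ?thesis
    using assms by (simp add: sum.inter_restrict[symmetric] Int_absorb1)
qed

lemma char_ext_SET_INV: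
  assumes fin: "finite (carrier G)" and \<chi>: "\<chi> \<in> characters G" and A: "A \<subseteq> carrier G"
  shows "char_ext G \<chi> (indicator (SET_INV G A)) = cnj (char_ext G \<chi> (indicator A))"
proof -
  have img: "SET_INV G A = (\<lambda>x. inv x) ` A" by (auto simp: SET_INV_def)
  have inv_sub: "SET_INV G A \<subseteq> carrier G"
    unfolding img using A by auto
  have "inj_on (\<lambda>x. inv x) A"
    using A by (intro inj_onI) (metis inv_inv subsetD)
  then have "(\<Sum>x\<in>SET_INV G A. \<chi> x) = (\<Sum>x\<in>A. \<chi> (inv x))"
    by (simp add: img sum.reindex)
  also have "\<dots> = (\<Sum>x\<in>A. cnj (\<chi> x))"
    using A character_inv[OF fin \<chi>] by (intro sum.cong) auto
  finally show ?thesis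
    using char_ext_indicator[OF fin A, of \<chi>] char_ext_indicator[OF fin inv_sub, of \<chi>] by simp
qed

end

section \<open>Parity of group ring coefficients\<close>

lemma of_int_bit_eq_0_iff: "(of_int n :: bit) = 0 \<longleftrightarrow> even n"
proof (cases "even n")
  case True
  then obtain k where "n = 2 * k" by (elim evenE)
  then show ?thesis using True by simp
next
  case False
  then obtain k where "n = 2 * k + 1" by (elim oddE)
  then have "(of_int n :: bit) = of_int (2 * k) + 1" by (simp del: add_bit_eq_xor)
  also have "(of_int (2 * k) :: bit) = 0" by simp
  finally show ?thesis using False by simp
qed

text \<open>Over the field \<open>bit\<close> of characteristic 2, the equal terms at
  \<open>x\<close> and \<open>h x\<close> are negatives of each other and cancel.\<close>

lemma even_sum_involution:
  fixes f :: "'a \<Rightarrow> int"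
  assumes "\<And>x. x \<in> X \<Longrightarrow> f (h x) = f x"
    and "\<And>x. x \<in> X \<Longrightarrow> h x \<in> X" "\<And>x. x \<in> X \<Longrightarrow> h (h x) = x" "\<And>x. x \<in> X \<Longrightarrow> h x \<noteq> x"
  shows "even (\<Sum>x\<in>X. f x)"
proof -
  have "(of_int (f (h x)) + of_int (f x) :: bit) = 0" if "x \<in> X" for x
    using assms(1)[OF that] by simp
  then have "(\<Sum>x\<in>X. of_int (f x) :: bit) = 0"
    using assms(2-4) by (intro sum_involution_eq_0[where h = h]) auto
  then have "(of_int (\<Sum>x\<in>X. f x) :: bit) = 0"
    by (simp only: of_int_sum)
  then show ?thesis
    by (simp only: of_int_bit_eq_0_iff)
qed

context comm_group
begin

text \<open>If the order is \<open>2 * r + 1\<close>, then raising to the power \<open>r + 1\<close>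
  undoes squaring.\<close>

lemma square_inj_of_odd_order:
  assumes "odd (order G)" and "x \<in> carrier G" "y \<in> carrier G" and "x \<otimes> x = y \<otimes> y"
  shows "x = y"
proof -
  obtain r where r: "order G = 2 * r + 1" using assms(1) by (elim oddE)
  have *: "(z \<otimes> z) [^] (r + 1) = z" if "z \<in> carrier G" for z
  proof -
    have "(z \<otimes> z) [^] (r + 1) = (z [^] (2::nat)) [^] (r + 1)"
      using that by (simp add: numeral_2_eq_2)
    also have "\<dots> = z [^] Suc (order G)"
      using that unfolding nat_pow_pow[OF that] by (simp add: r mult_2 del: nat_pow_Suc)
    finally show ?thesis using that pow_order_eq_1[OF that] by simp
  qed
  show ?thesis using *[OF assms(2)] *[OF assms(3)] assms(4) by simp
qed

text \<open>The Frobenius identity in characteristic 2: off the diagonal, the terms for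
  \<open>(y, z)\<close> and \<open>(z, y)\<close> cancel.\<close>

lemma gr_mult_self_mod_2:
  assumes fin: "finite (carrier G)" and "odd (order G)" and x: "x \<in> carrier G"
  shows "even (gr_mult G f f (x \<otimes> x)) \<longleftrightarrow> even (f x)"
proof -
  define S where "S = {(y, z) \<in> carrier G \<times> carrier G. y \<otimes> z = x \<otimes> x}"
  have "finite S"
    unfolding S_def by (rule finite_subset[of _ "carrier G \<times> carrier G"]) (use fin in auto)
  have SD: "(y, z) \<in> S \<longleftrightarrow> y \<in> carrier G \<and> z \<in> carrier G \<and> y \<otimes> z = x \<otimes> x" for y z
    by (simp add: S_def)
  have "(x, x) \<in> S" using x by (simp add: S_def)
  have "gr_mult G f f (x \<otimes> x) = f x * f x + (\<Sum>(y, z)\<in>S - {(x, x)}. f y * f z)"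
    using sum.remove[OF \<open>finite S\<close> \<open>(x, x) \<in> S\<close>, of "\<lambda>(y, z). f y * f z"]
    unfolding gr_mult_def S_def[symmetric] by (simp only: prod.case)
  moreover have "even (\<Sum>p\<in>S - {(x, x)}. case p of (y, z) \<Rightarrow> f y * f z)"
  proof (rule even_sum_involution[where h = prod.swap])
    fix p assume pS: "p \<in> S - {(x, x)}"
    obtain y z where yz: "p = (y, z)" by (rule prod.exhaust)
    have p: "y \<in> carrier G" "z \<in> carrier G" "y \<otimes> z = x \<otimes> x" "\<not> (y = x \<and> z = x)"
      using pS unfolding yz by (simp_all only: SD Diff_iff singleton_iff prod.inject) blast+
    \<comment> \<open>A pair fixed by the swap is \<open>(y, y)\<close> with
      \<open>y \<otimes> y = x \<otimes> x\<close>. Uniqueness of square roots makes it the removed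
      pair \<open>(x, x)\<close>.\<close>
    show "prod.swap p \<noteq> p"
    proof
      assume "prod.swap p = p"
      then have "z = y" unfolding yz swap_simp by (rule Pair_inject)
      then show False
        using p square_inj_of_odd_order[OF assms(2) p(1) x] by metis
    qed
    show "prod.swap p \<in> S - {(x, x)}"
    proof
      show "prod.swap p \<in> S"
        unfolding yz swap_simp SD using p(1-3) m_comm[OF p(1,2)] by metis
      show "prod.swap p \<notin> {(x, x)}"
        unfolding yz swap_simp using p(4) by blast
    qed
    show "(case prod.swap p of (y, z) \<Rightarrow> f y * f z) = (case p of (y, z) \<Rightarrow> f y * f z)"
      using yz by (simp add: mult.commute)
    show "prod.swap (prod.swap p) = p" by simp
  qed
  ultimately show ?thesis by simp
qed

end


section \<open>Character values of strong external difference families\<close>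

context comm_group
begin

text \<open>The character is applied to the defining equation; the inverses of the other blocks
  contribute the conjugate of their character sum. The sum of \<open>\<chi>\<close> over the group
  stays unevaluated, so that both nonprincipal characters and the principal one are covered.\<close>

lemma SEDF_char_ext:
  assumes S: "SEDF G v m k l D" and j: "j \<in> {1..m}" and \<chi>: "\<chi> \<in> characters G"
  shows "char_ext G \<chi> (indicator (D j)) *
           cnj (char_ext G \<chi> (indicator (\<Union>i\<in>{1..m}. D i)) - char_ext G \<chi> (indicator (D j)))
         = of_nat l * ((\<Sum>x\<in>carrier G. \<chi> x) - 1)"
proof -
  have fin: "finite (carrier G)" and sub: "\<And>i. i \<in> {1..m} \<Longrightarrow> D i \<subseteq> carrier G"
    and disj: "disjoint_family_on D {1..m}"
    and eq: "gr_mult G (indicator (D j)) (\<lambda>x. \<Sum>i\<in>{1..m} - {j}. indicator (SET_INV G (D i)) x)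
        = (\<lambda>x. int l * (indicator (carrier G) x - indicator {\<one>} x))"
    using S j by (auto simp: SEDF_def)
  let ?x = "\<lambda>i. char_ext G \<chi> (indicator (D i))"
  have D: "char_ext G \<chi> (indicator (\<Union>i\<in>{1..m}. D i)) = (\<Sum>i\<in>{1..m}. ?x i)"
  proof -
    have "char_ext G \<chi> (indicator (\<Union>i\<in>{1..m}. D i)) = (\<Sum>x\<in>(\<Union>i\<in>{1..m}. D i). \<chi> x)"
      using sub by (intro char_ext_indicator[OF fin] UN_least)
    also have "\<dots> = (\<Sum>i\<in>{1..m}. \<Sum>x\<in>D i. \<chi> x)"
      using disj finite_subset[OF sub fin]
      by (intro sum.UNION_disjoint ballI) (auto simp: disjoint_family_on_def)
    finally show ?thesis
      using char_ext_indicator[OF fin sub] by simp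
  qed
  have "char_ext G \<chi> (\<lambda>x. \<Sum>i\<in>{1..m} - {j}. indicator (SET_INV G (D i)) x)
      = (\<Sum>i\<in>{1..m} - {j}. char_ext G \<chi> (indicator (SET_INV G (D i))))"
    unfolding char_ext_def of_int_sum sum_distrib_right by (rule sum.swap)
  also have "\<dots> = (\<Sum>i\<in>{1..m} - {j}. cnj (?x i))"
    using char_ext_SET_INV[OF fin \<chi> sub] by (intro sum.cong) auto
  also have "\<dots> = cnj ((\<Sum>i\<in>{1..m}. ?x i) - ?x j)"
    using j by (simp add: sum_diff1)
  finally have "?x j * cnj ((\<Sum>i\<in>{1..m}. ?x i) - ?x j) =
      char_ext G \<chi> (\<lambda>x. int l * (indicator (carrier G) x - indicator {\<one>} x))"
    using char_ext_gr_mult[OF fin \<chi>] by (simp flip: eq)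
  also have "\<dots> = of_nat l * (char_ext G \<chi> (indicator (carrier G)) - char_ext G \<chi> (indicator {\<one>}))"
    unfolding char_ext_def sum_subtractf[symmetric] sum_distrib_left
    by (intro sum.cong) (simp_all add: algebra_simps)
  also have "\<dots> = of_nat l * ((\<Sum>x\<in>carrier G. \<chi> x) - 1)"
    using char_ext_indicator[OF fin, of "carrier G"] char_ext_indicator[OF fin, of "{\<one>}"]
    by (simp add: character_one[OF \<chi>])
  finally show ?thesis by (simp only: D)
qed

end

text \<open>Writing \<open>x = \<chi>(D)\<close> and \<open>y = \<chi>(D\<^sub>j)\<close>, the first hypothesis makes \<open>y * cnj x\<close> real,
  so \<open>y = t * x\<close> with \<open>t\<close> real and \<open>(2 * t - 1)\<^sup>2 = 1 + 4 * l / \<bar>x\<bar>\<^sup>2\<close>.\<close>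

lemma char_value_square:
  fixes x y :: complex and a b :: int and l :: nat
  assumes eq: "y * cnj (x - y) = - of_nat l" and "x \<noteq> 0" and "a > 0"
    and sqrt: "sqrt (1 + 4 * real l / (cmod x)\<^sup>2) = of_int b / of_int a"
  shows "(2 * of_int a * y - of_int a * x)\<^sup>2 = (of_int b)\<^sup>2 * x\<^sup>2"
proof -
  define n where "n = (cmod x)\<^sup>2"
  \<comment> \<open>This is the ratio \<open>y / x\<close>, read off from
    \<open>y * cnj x = (cmod y)\<^sup>2 - l\<close>, which is the hypothesis rearranged.\<close>
  define t where "t = ((cmod y)\<^sup>2 - real l) / n"
  have n: "n > 0" "x * cnj x = of_real n"
    using \<open>x \<noteq> 0\<close> by (simp_all add: n_def complex_norm_square[symmetric])
  have "y * cnj x = of_real ((cmod y)\<^sup>2 - real l)"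
    using eq by (simp add: algebra_simps complex_norm_square[symmetric])
  then have "y * (x * cnj x) = of_real ((cmod y)\<^sup>2 - real l) * x"
    by (metis mult.commute mult.left_commute)
  then have "y * of_real n = of_real ((cmod y)\<^sup>2 - real l) * x"
    by (simp only: n(2))
  then have y: "y = of_real t * x"
    using n(1) by (simp add: t_def field_simps)
  have "of_real (t * (1 - t) * n) = y * cnj (x - y)"
    unfolding of_real_mult n(2)[symmetric] by (simp add: y algebra_simps)
  then have "of_real (t * (1 - t) * n) = (of_real (- real l) :: complex)"
    using eq by simp
  then have tn: "t * (1 - t) * n = - real l"
    by (simp only: of_real_eq_iff)
  have "(2 * t - 1)\<^sup>2 = 1 - 4 * (t * (1 - t))"
    by (simp add: power2_eq_square algebra_simps)
  also have "t * (1 - t) = - real l / n"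
    using tn n(1) by (simp add: field_simps)
  also have "1 - 4 * (- real l / n) = (sqrt (1 + 4 * real l / n))\<^sup>2"
    using n(1) by simp
  also have "\<dots> = (of_int b / of_int a)\<^sup>2"
    using sqrt by (simp add: n_def)
  finally have "(of_int a)\<^sup>2 * (2 * t - 1)\<^sup>2 = (of_int b)\<^sup>2"
    using \<open>a > 0\<close> by (simp add: power_divide)
  then have "complex_of_real ((of_int a)\<^sup>2 * (2 * t - 1)\<^sup>2) = of_real ((of_int b)\<^sup>2)"
    by simp
  then have "(of_int a)\<^sup>2 * (2 * of_real t - 1)\<^sup>2 = (of_int b :: complex)\<^sup>2"
    by simp
  moreover have "(2 * of_int a * y - of_int a * x)\<^sup>2 = (of_int a)\<^sup>2 * (2 * of_real t - 1)\<^sup>2 * x\<^sup>2"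
    by (simp add: y power2_eq_square algebra_simps)
  ultimately show ?thesis by simp
qed

section \<open>The blocks do not exhaust the group\<close>

text \<open>The equation forces \<open>k\<close> to divide \<open>l\<close>. With
  \<open>l = k * c\<close> and \<open>c > 0\<close>, cancelling \<open>k\<close> gives
  \<open>m * k - k = c * (m * k - 1) \<ge> m * k - 1\<close>, that is
  \<open>k \<le> 1\<close>.\<close>

lemma no_partition_parameters:
  fixes k l m :: nat
  assumes eq: "int k * int (m * k - k) = int l * (int (m * k) - 1)"
    and "k > 1" "m > 1" "l \<ge> 1"
  shows False
proof -
  have e: "int k * (int m * int k - int k) = int l * (int m * int k - 1)"
    using eq \<open>m > 1\<close> by (simp add: of_nat_diff)
  \<comment> \<open>On the right-hand side of \<open>e\<close>, every term except \<open>- l\<close>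
    is a multiple of \<open>k\<close>; isolating \<open>l\<close> exhibits the cofactor.\<close>
  then have "int l = int k * (int l * int m - (int m * int k - int k))"
    by (simp add: algebra_simps)
  then obtain c where c: "int l = int k * c" by (rule that)
  have "c > 0"
  proof -
    have "int k * c > 0" using c \<open>l \<ge> 1\<close> by simp
    then show ?thesis by (simp add: zero_less_mult_iff)
  qed
  have "int k * (int m * int k - int k) = int k * (c * (int m * int k - 1))"
    using e c by (simp add: algebra_simps)
  then have e2: "int m * int k - int k = c * (int m * int k - 1)"
    using \<open>k > 1\<close> by simp
  have "int m * int k \<ge> 1"
    using mult_mono[of 1 "int m" 1 "int k"] assms by simp
  then have "1 * (int m * int k - 1) \<le> c * (int m * int k - 1)"
    using \<open>c > 0\<close> by (intro mult_right_mono) auto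
  also have "\<dots> = int m * int k - int k"
    by (rule e2[symmetric])
  finally have "int k \<le> 1" by simp
  with \<open>k > 1\<close> show False by simp
qed

context comm_group
begin

text \<open>If the blocks covered the group, its order would be \<open>m * k\<close>. The principal
  character turns the defining equation into the count
  \<open>k * (m * k - k) = l * (m * k - 1)\<close>, which \<open>no_partition_parameters\<close>
  refutes.\<close>

lemma SEDF_union_ne_carrier:
  assumes S: "SEDF G v m k l D" and "k > 1"
  shows "(\<Union>i\<in>{1..m}. D i) \<noteq> carrier G"
proof
  assume full: "(\<Union>i\<in>{1..m}. D i) = carrier G"
  have fin: "finite (carrier G)" and "m \<ge> 2" "l \<ge> 1"
    and D: "\<And>i. i \<in> {1..m} \<Longrightarrow> D i \<subseteq> carrier G" "\<And>i. i \<in> {1..m} \<Longrightarrow> card (D i) = k"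
    and disj: "disjoint_family_on D {1..m}"
    using S by (auto simp: SEDF_def)
  have one: "1 \<in> {1..m}" using \<open>m \<ge> 2\<close> by simp
  have card: "card (carrier G) = m * k"
    unfolding full[symmetric]
    using disj finite_subset[OF D(1) fin] D(2)
    by (subst card_UN_disjoint) (auto simp: disjoint_family_on_def)
  let ?\<chi> = "principal_character G"
  have val: "char_ext G ?\<chi> (indicator A) = of_nat (card A)" if "A \<subseteq> carrier G" for A
  proof -
    have "char_ext G ?\<chi> (indicator A) = (\<Sum>x\<in>A. ?\<chi> x)"
      by (rule char_ext_indicator[OF fin that])
    also have "\<dots> = (\<Sum>x\<in>A. 1)"
      using that by (intro sum.cong) (auto simp: principal_character_def)
    finally show ?thesis by simp
  qed
  have sum: "(\<Sum>x\<in>carrier G. ?\<chi> x) = of_nat (m * k)"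
    by (simp add: principal_character_def card)
  have "of_nat k * cnj (of_nat (m * k) - of_nat k) = (of_nat l * (of_nat (m * k) - 1) :: complex)"
    using SEDF_char_ext[OF S one principal_character_mem]
    unfolding full sum val[OF subset_refl] val[OF D(1)[OF one]] card D(2)[OF one] .
  then have "(of_int (int k * (int (m * k) - int k)) :: complex) = of_int (int l * (int (m * k) - 1))"
    by simp
  then have "int k * (int (m * k) - int k) = int l * (int (m * k) - 1)"
    by (simp only: of_int_eq_iff)
  then have "int k * int (m * k - k) = int l * (int (m * k) - 1)"
    using \<open>m \<ge> 2\<close> by (simp add: of_nat_diff)
  then show False
    using no_partition_parameters \<open>k > 1\<close> \<open>m \<ge> 2\<close> \<open>l \<ge> 1\<close> by force
qed

section \<open>A group ring element with vanishing nonprincipal character values\<close>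

lemma char_ext_linear:
  "char_ext G \<chi> (\<lambda>x. c * f x + d * g x) = of_int c * char_ext G \<chi> f + of_int d * char_ext G \<chi> g"
  by (simp add: char_ext_def sum_distrib_left sum.distrib algebra_simps)

text \<open>With \<open>E = D\<^sup>2\<close>, the group ring element
  \<open>((2 a D\<^sub>1 - a D)\<^sup>2 - b\<^sup>2 D\<^sup>2) D\<^sup>2\<close> is annihilated by every nonprincipal character:
  the first factor vanishes on \<open>\<chi>\<close> if \<open>\<chi>(D) \<noteq> 0\<close>, the second one otherwise.\<close>

lemma SEDF_char_value_identity:
  fixes a b :: int
  assumes S: "SEDF G v m k l D" and scv: "simple_char_value_property G m l D a b"
    and \<chi>: "\<chi> \<in> characters G" "\<chi> \<noteq> principal_character G"
  defines "U \<equiv> (indicator (\<Union>i\<in>{1..m}. D i) :: 'a \<Rightarrow> int)" and "A \<equiv> (indicator (D 1) :: 'a \<Rightarrow> int)"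
  defines "E \<equiv> gr_mult G U U"
  defines "B \<equiv> \<lambda>x. 1 * gr_mult G (gr_mult G A A) E x + (- 1) * gr_mult G (gr_mult G A U) E x"
  shows "char_ext G \<chi> (\<lambda>x. (a\<^sup>2 - b\<^sup>2) * gr_mult G E E x + 4 * a\<^sup>2 * B x) = 0"
proof -
  have fin: "finite (carrier G)" and one: "1 \<in> {1..m}"
    using S by (auto simp: SEDF_def)
  define x where "x = char_ext G \<chi> U"
  define y where "y = char_ext G \<chi> A"
  \<comment> \<open>The expansion of \<open>(2 a y - a x)\<^sup>2\<close> is
    \<open>a\<^sup>2 x\<^sup>2 + 4 a\<^sup>2 (y\<^sup>2 - x y)\<close>. The terms with the factor 4
    are collected in \<open>B\<close>, which makes the residue modulo 2 visible. The coefficients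
    \<open>1\<close> and \<open>- 1\<close> in \<open>B\<close> match the shape of
    \<open>char_ext_linear\<close>.\<close>
  have "char_ext G \<chi> (\<lambda>x. (a\<^sup>2 - b\<^sup>2) * gr_mult G E E x + 4 * a\<^sup>2 * B x) =
      ((2 * of_int a * y - of_int a * x)\<^sup>2 - (of_int b)\<^sup>2 * x\<^sup>2) * x\<^sup>2"
    unfolding char_ext_linear B_def E_def char_ext_gr_mult[OF fin \<chi>(1)] x_def y_def
    by (simp add: power2_eq_square algebra_simps)
  also have "\<dots> = 0"
  proof (cases "x = 0")
    case False
    then have "\<chi> \<in> chars_N G (\<Union>i\<in>{1..m}. D i)"
      using \<chi> by (simp add: chars_N_def x_def U_def)
    then have "char_value_pair G l (\<Union>i\<in>{1..m}. D i) \<chi> a b"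
      using scv unfolding simple_char_value_property_def by blast
    then have "a > 0" "sqrt (1 + 4 * real l / (cmod x)\<^sup>2) = of_int b / of_int a"
      unfolding char_value_pair_def x_def U_def by auto
    moreover have "y * cnj (x - y) = - of_nat l"
      using SEDF_char_ext[OF S one \<chi>(1)] sum_character_eq_0[OF fin \<chi>]
      unfolding x_def y_def U_def A_def by simp
    ultimately have "(2 * of_int a * y - of_int a * x)\<^sup>2 = (of_int b)\<^sup>2 * x\<^sup>2"
      using char_value_square False by blast
    then show ?thesis by simp
  qed simp
  finally show ?thesis .
qed

end

section \<open>The parity contradiction\<close>

theorem theorem5p10:
  fixes G :: "('a, 'c) monoid_scheme"
    and p s v m k l :: nat
    and D :: "nat \<Rightarrow> 'a set"
    and a b :: int
  assumes "comm_group G" and "finite (carrier G)"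
    and "order G = v" and "v = p ^ s"
    and "prime p" and "odd p"
    and "self_conjugate 2 (group_exponent G)"
    and "nontrivial_SEDF G v m k l D" and "m > 2"
    and "simple_char_value_property G m l D a b"
  shows "odd a \<and> odd b"
proof (rule ccontr)
  assume parity: "\<not> (odd a \<and> odd b)"
  interpret comm_group G by fact
  note fin = assms(2)
  have S: "SEDF G v m k l D" and "k > 1"
    using assms(8) by (auto simp: nontrivial_SEDF_def)
  have "odd (order G)" using assms(3,4,6) by simp
  define V where "V = (\<Union>i\<in>{1..m}. D i)"
  define U where "U = (indicator V :: 'a \<Rightarrow> int)"
  define E where "E = gr_mult G U U"
  \<comment> \<open>\<open>W\<close> serves both cases at once: it is constant on the group by
    Fourier inversion and congruent to the fourth power of \<open>U\<close> modulo 2.\<close>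
  have "\<exists>W. (\<forall>\<chi>\<in>characters G. \<chi> \<noteq> principal_character G \<longrightarrow> char_ext G \<chi> W = 0) \<and>
      (\<forall>x. even (W x) \<longleftrightarrow> even (gr_mult G E E x))"
  proof (cases "chars_N G V = {}")
    case True
    \<comment> \<open>Here every nonprincipal character vanishes on \<open>V\<close>, hence on the
      fourth power of \<open>U\<close>, which is taken as \<open>W\<close>.\<close>
    have "char_ext G \<chi> (gr_mult G E E) = 0"
      if "\<chi> \<in> characters G" "\<chi> \<noteq> principal_character G" for \<chi>
      using True that unfolding chars_N_def E_def U_def char_ext_gr_mult[OF fin that(1)] by auto
    then show ?thesis by blast
  next
    case False
    then obtain \<chi> where "char_value_pair G l V \<chi> a b"
      using assms(10) unfolding simple_char_value_property_def V_def by blast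
    then have "coprime a b" by (simp add: char_value_pair_def)
    \<comment> \<open>Coprimality excludes that both are even, so \<open>a\<close> and
      \<open>b\<close> have opposite parity.\<close>
    then have "odd (a\<^sup>2 - b\<^sup>2)"
      using parity by (auto dest: coprime_common_divisor[of a b 2])
    define B where "B x = 1 * gr_mult G (gr_mult G (indicator (D 1)) (indicator (D 1))) E x +
      (- 1) * gr_mult G (gr_mult G (indicator (D 1)) U) E x" for x
    let ?W = "\<lambda>x. (a\<^sup>2 - b\<^sup>2) * gr_mult G E E x + 4 * a\<^sup>2 * B x"
    have "char_ext G \<chi> ?W = 0"
      if "\<chi> \<in> characters G" "\<chi> \<noteq> principal_character G" for \<chi>
      unfolding B_def E_def U_def V_def by (rule SEDF_char_value_identity[OF S assms(10) that])
    moreover have "even (?W x) \<longleftrightarrow> even (gr_mult G E E x)" for x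
      using \<open>odd (a\<^sup>2 - b\<^sup>2)\<close> by simp
    ultimately show ?thesis by (intro exI[of _ ?W]) blast
  qed
  then obtain W where W:
      "\<And>\<chi>. \<chi> \<in> characters G \<Longrightarrow> \<chi> \<noteq> principal_character G \<Longrightarrow> char_ext G \<chi> W = 0"
      "\<And>x. even (W x) \<longleftrightarrow> even (gr_mult G E E x)"
    by blast
  \<comment> \<open>Two applications of the Frobenius identity carry the parity of \<open>U\<close>
    at \<open>x\<close> to that of \<open>W\<close> at the fourth power of \<open>x\<close>;
    constancy of \<open>W\<close> then moves it to the identity.\<close>
  have U_even: "even (U x) \<longleftrightarrow> even (W \<one>\<^bsub>G\<^esub>)" if x: "x \<in> carrier G" for x
  proof -
    have "even (U x) \<longleftrightarrow> even (W ((x \<otimes>\<^bsub>G\<^esub> x) \<otimes>\<^bsub>G\<^esub> (x \<otimes>\<^bsub>G\<^esub> x)))"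
      using x gr_mult_self_mod_2[OF fin \<open>odd (order G)\<close>] by (simp add: W(2) E_def)
    then show ?thesis
      using constant_if_nonprincipal_eq_0[OF fin W(1), of "(x \<otimes>\<^bsub>G\<^esub> x) \<otimes>\<^bsub>G\<^esub> (x \<otimes>\<^bsub>G\<^esub> x)" "\<one>\<^bsub>G\<^esub>"] x by simp
  qed
  have V: "V \<subseteq> carrier G" and "card (D 1) = k" "1 \<in> {1..m}"
    using S by (auto simp: SEDF_def V_def)
  then have "D 1 \<noteq> {}" "D 1 \<subseteq> V"
    using \<open>k > 1\<close> unfolding V_def by (metis card.empty not_less_zero, blast)
  then obtain d where "d \<in> V" "d \<in> carrier G"
    using V by blast
  \<comment> \<open>One element of \<open>V\<close> makes the common parity odd, so the indicator
    \<open>U\<close> is 1 on the whole group.\<close>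
  then have "odd (W \<one>\<^bsub>G\<^esub>)" using U_even[of d] by (simp add: U_def)
  then have "x \<in> V" if "x \<in> carrier G" for x
    using U_even[OF that] by (auto simp: U_def indicator_def split: if_splits)
  then have "V = carrier G" using V by blast
  then show False
    using SEDF_union_ne_carrier[OF S \<open>k > 1\<close>] by (simp add: V_def)
qed

end
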